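(* The Gordian complex $\mathcal{G}_T$ of welded knots by twist move contains the infinite family of welded knots $\{WK_n\}_{n\geq 0}$ (specified by explicit Gauss codes), and this family satisfies $d_T(WK_m,WK_n)\leq 1$ for all distinct integers $m,n\geq 0$.
   Context: A welded knot diagram is a generic immersion of one circle in the plane in which every double point is marked either as a classical crossing (with over/under information) or as a welded crossing (no over/under information). Welded Reidemeister moves are: the classical Reidemeister moves RI, RII, RIII; the moves VRI, VRII, VRIII (the versions of RI, RII, RIII in which all crossings are welded); the move SV (the Reidemeister-III-type move in which an arc having two welded crossings is moved across a classical crossing); and the move $F_1$ (the Reidemeister-III-type move in which an arc passing over two strands at two classical crossings is moved across the welded crossing of these two strands). Two diagrams are equivalent if related by a finite sequence of welded Reidemeister moves (and planar isotopy); a welded knot is an equivalence class. The trivial welded knot is the class of the diagram without crossings. A diagram up to VRI, VRII, VRIII, SV is determined by its signed Gauss diagram (one arrow per classical crossing, from over- to under-passage, labelled by the sign of the crossing), equivalently by its cyclic signed Gauss code; $F_1$ exchanges two adjacent arrow tails (two adjacent letters $O$). Every signed Gauss code is realized by a welded knot diagram, so a signed Gauss code determines a welded knot. Twist move at a classical crossing $c$: replace a small neighbourhood of $c$, viewed as a 2-strand tangle consisting of the single crossing $c$, by the 2-strand tangle obtained by placing a welded crossing of the two strands on each of two opposite sides of the classical crossing (a vertical stack welded–classical–welded), the classical crossing being drawn with the same picture; the inverse replacement is also a twist move. It exchanges the over- and under-passing strands at $c$ while preserving the sign of $c$ (on the Gauss diagram: reverses the arrow of $c$, keeps its sign). Twist-distance: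 $d_T(K,K')$ is the minimum number of twist moves required to convert a diagram $D$ of $K$ into a diagram $D'$ of $K'$ by a finite sequence of twist moves and welded Reidemeister moves, the minimum being over all diagrams $D$ of $K$ and $D'$ of $K'$. The Gordian complex $\mathcal{G}_T$ has all welded knots as vertices, and a set $\{K_0,\dots,K_r\}$ spans an $r$-simplex if and only if $d_T(K_i,K_j)=1$ for all $i\ne j$. The knots $WK_n$: $WK_0$ is the trivial welded knot. For $n\ge1$, $WK_n$ has $6n$ classical crossings $a_i,b_i,c_i,d_i,e_i,f_i$ ($1\le i\le n$; block $i$). Writing $O_x$, $U_x$ for the over- and under-passage of crossing $x$, put $$R_i=O_{a_i}O_{b_i}U_{d_i}O_{c_i}O_{e_i}O_{f_i}U_{c_i}O_{d_i},\quad P_i=U_{f_i}U_{a_i}\quad(1\le i\le n),$$ $$Q_1=U_{e_1}U_{b_1},\qquad Q_i=U_{b_i}U_{e_i}\quad(2\le i\le n).$$ The cyclic Gauss code of $WK_n$ is $$Q_1\,P_1\,(Q_2\,R_1\,P_2)\,(Q_3\,R_2\,P_3)\cdots(Q_n\,R_{n-1}\,P_n)\,R_n$$ (for $n=1$ this is $Q_1P_1R_1$). The signs are: $a_i:+$, $f_i:-$, $c_i:+$, $d_i:-$ for all $i$; $b_1:+$, $e_1:-$; and $b_i:-$, $e_i:+$ for $i\ge2$. *)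

theory Defs
  imports Main "HOL-Library.Extended_Nat"
begin

text \<open>
  Welded knot diagrams are represented by their signed Gauss codes. A diagram is determined by its
  cyclic signed Gauss code up to the moves VRI, VRII, VRIII and SV (which do not change the code),
  and every signed Gauss code comes from a diagram. A code is read from a base point on the circle
  and names the crossings by natural numbers; both choices are factored out below, by the moves
  \<open>rotate\<close> and \<open>relabel\<close>.
\<close>

datatype crossing_sign = Pos | Neg

fun opp :: "crossing_sign \<Rightarrow> crossing_sign" where
  "opp Pos = Neg"
| "opp Neg = Pos"

datatype passage =
    Over (label: nat) (sign: crossing_sign)
  | Under (label: nat) (sign: crossing_sign)

type_synonym code = "passage list"

text \<open>
  Every crossing that occurs is passed exactly once over and once under, with one and the same sign.
\<close>

definition gauss_code :: "code \<Rightarrow> bool" where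
  "gauss_code D \<longleftrightarrow>
     distinct D \<and>
     (\<forall>x s. Over x s \<in> set D \<longleftrightarrow> Under x s \<in> set D) \<and>
     (\<forall>p\<in>set D. \<forall>q\<in>set D. label p = label q \<longrightarrow> sign p = sign q)"

fun relabel_passage :: "(nat \<Rightarrow> nat) \<Rightarrow> passage \<Rightarrow> passage" where
  "relabel_passage f (Over x s) = Over (f x) s"
| "relabel_passage f (Under x s) = Under (f x) s"

definition pair :: "bool \<Rightarrow> 'a \<Rightarrow> 'a \<Rightarrow> 'a list" where
  "pair c p q = (if c then [p, q] else [q, p])"

text \<open>
  In the third Reidemeister move the top strand passes over the middle strand at \<open>x\<close> (sign \<open>r\<close>) and
  over the bottom strand at \<open>y\<close> (sign \<open>s\<close>); the middle strand passes over the bottom strand at \<open>z\<close>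
  (sign \<open>t\<close>). The flag \<open>i\<close> (resp. \<open>j\<close>, \<open>k\<close>) says that the top (resp. middle, bottom) strand runs
  through its two crossings in the order \<open>x, y\<close> (resp. \<open>x, z\<close> and \<open>y, z\<close>); the move reverses all
  three orders.

  The following condition says which orders and signs belong to an actual triangle of three
  oriented lines in the plane. Let the top and middle line pass through the origin with directions
  \<open>T\<close> and \<open>M\<close>, and the bottom line through \<open>q\<close> with direction \<open>B\<close>. Identifying signs and flags with
  \<open>1\<close> and \<open>-1\<close>, one has \<open>r = sgn (T \<times> M)\<close>, \<open>s = sgn (T \<times> B)\<close>, \<open>t = sgn (M \<times> B)\<close>. With
  \<open>h = sgn (q \<times> B)\<close>, solving for the points of intersection gives \<open>i = h s\<close>, \<open>j = h t\<close>,
  \<open>k = h r s t\<close>. All \<open>r, s, t, h\<close> occur, and eliminating \<open>h\<close> leaves \<open>i j = s t\<close> and \<open>i k = r t\<close>.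
\<close>

definition triangle ::
    "bool \<Rightarrow> bool \<Rightarrow> bool \<Rightarrow> crossing_sign \<Rightarrow> crossing_sign \<Rightarrow> crossing_sign \<Rightarrow> bool" where
  "triangle i j k r s t \<longleftrightarrow> ((i = j) = (s = t)) \<and> ((i = k) = (r = t))"

text \<open>
  The moves are given in one direction only; inverse moves come in with the equivalence closure.
  It suffices to let the over-passing pair in \<open>RII\<close> and the top strand in \<open>RIII\<close> come first in
  the code, because the base point may be moved by \<open>rotate\<close>. Fresh crossing names in \<open>RI\<close> and
  \<open>RII\<close> are enforced by requiring both sides of a move to be Gauss codes (\<open>welded_move\<close> below).
\<close>

inductive move :: "code \<Rightarrow> code \<Rightarrow> bool" where
  rotate: "move (u @ v) (v @ u)"
| relabel: "inj f \<Longrightarrow> move D (map (relabel_passage f) D)"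
| RI_over: "move (u @ v) (u @ [Over x s, Under x s] @ v)"
| RI_under: "move (u @ v) (u @ [Under x s, Over x s] @ v)"
| RII: "move (u @ v @ w)
    (u @ [Over x s, Over y (opp s)] @ v @ pair c (Under x s) (Under y (opp s)) @ w)"
| RIII_top_middle_bottom: "triangle i j k r s t \<Longrightarrow>
    move
      (u @ pair i (Over x r) (Over y s) @ v @ pair j (Under x r) (Over z t)
         @ w @ pair k (Under y s) (Under z t) @ u')
      (u @ pair (\<not> i) (Over x r) (Over y s) @ v @ pair (\<not> j) (Under x r) (Over z t)
         @ w @ pair (\<not> k) (Under y s) (Under z t) @ u')"
| RIII_top_bottom_middle: "triangle i j k r s t \<Longrightarrow>
    move
      (u @ pair i (Over x r) (Over y s) @ v @ pair k (Under y s) (Under z t)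
         @ w @ pair j (Under x r) (Over z t) @ u')
      (u @ pair (\<not> i) (Over x r) (Over y s) @ v @ pair (\<not> k) (Under y s) (Under z t)
         @ w @ pair (\<not> j) (Under x r) (Over z t) @ u')"
| F1: "move (u @ [Over x r, Over y s] @ v) (u @ [Over y s, Over x r] @ v)"

definition welded_move :: "code \<Rightarrow> code \<Rightarrow> bool" where
  "welded_move D D' \<longleftrightarrow> gauss_code D \<and> gauss_code D' \<and> move D D'"

definition welded_equiv :: "(code \<times> code) set" where
  "welded_equiv = {(D, D'). gauss_code D \<and> gauss_code D' \<and> equivclp welded_move D D'}"

lemma equiv_welded_equiv: "equiv (Collect gauss_code) welded_equiv"
  by (rule equivI)
    (auto simp: welded_equiv_def refl_on_def sym_def trans_def
      intro: equivclp_sym equivclp_trans)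

definition welded_knots :: "code set set" where
  "welded_knots = Collect gauss_code // welded_equiv"

text \<open>
  The twist move at \<open>x\<close> exchanges the over- and the under-passage of \<open>x\<close> and preserves its sign.
\<close>

fun twist_passage :: "nat \<Rightarrow> passage \<Rightarrow> passage" where
  "twist_passage x (Over y s) = (if y = x then Under y s else Over y s)"
| "twist_passage x (Under y s) = (if y = x then Over y s else Under y s)"

definition twist :: "nat \<Rightarrow> code \<Rightarrow> code" where
  "twist x D = map (twist_passage x) D"

text \<open>\<open>twist_seq k D D'\<close>: a finite sequence of welded moves and exactly \<open>k\<close> twist moves.\<close>

inductive twist_seq :: "nat \<Rightarrow> code \<Rightarrow> code \<Rightarrow> bool" where
  start: "gauss_code D \<Longrightarrow> twist_seq 0 D D"
| welded: "twist_seq k D D' \<Longrightarrow> welded_move D' D'' \<or> welded_move D'' D' \<Longrightarrow> twist_seq k D D''"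
| twist: "twist_seq k D D' \<Longrightarrow> x \<in> label ` set D' \<Longrightarrow> twist_seq (Suc k) D (twist x D')"

text \<open>The distance is \<open>\<infinity>\<close> (the infimum of the empty set) if no such sequence exists.\<close>

definition twist_distance :: "code set \<Rightarrow> code set \<Rightarrow> enat" where
  "twist_distance K K' = Inf {enat k |k. \<exists>D\<in>K. \<exists>D'\<in>K'. twist_seq k D D'}"

text \<open>The set of simplices; the singletons are the vertices.\<close>

definition gordian_complex :: "code set set set" where
  "gordian_complex =
     {S. finite S \<and> S \<noteq> {} \<and> S \<subseteq> welded_knots \<and>
         (\<forall>K\<in>S. \<forall>K'\<in>S. K \<noteq> K' \<longrightarrow> twist_distance K K' = 1)}"

datatype wk_crossing = Ca | Cb | Cc | Cd | Ce | Cf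

definition wk_label :: "wk_crossing \<Rightarrow> nat \<Rightarrow> nat" where
  "wk_label x i = 6 * i + (case x of Ca \<Rightarrow> 0 | Cb \<Rightarrow> 1 | Cc \<Rightarrow> 2 | Cd \<Rightarrow> 3 | Ce \<Rightarrow> 4 | Cf \<Rightarrow> 5)"

definition wk_sign :: "wk_crossing \<Rightarrow> nat \<Rightarrow> crossing_sign" where
  "wk_sign x i = (case x of Ca \<Rightarrow> Pos | Cf \<Rightarrow> Neg | Cc \<Rightarrow> Pos | Cd \<Rightarrow> Neg
     | Cb \<Rightarrow> if i = 1 then Pos else Neg | Ce \<Rightarrow> if i = 1 then Neg else Pos)"

definition wk_over :: "wk_crossing \<Rightarrow> nat \<Rightarrow> passage" where
  "wk_over x i = Over (wk_label x i) (wk_sign x i)"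

definition wk_under :: "wk_crossing \<Rightarrow> nat \<Rightarrow> passage" where
  "wk_under x i = Under (wk_label x i) (wk_sign x i)"

definition wk_R :: "nat \<Rightarrow> code" where
  "wk_R i = [wk_over Ca i, wk_over Cb i, wk_under Cd i, wk_over Cc i,
             wk_over Ce i, wk_over Cf i, wk_under Cc i, wk_over Cd i]"

definition wk_P :: "nat \<Rightarrow> code" where
  "wk_P i = [wk_under Cf i, wk_under Ca i]"

definition wk_Q :: "nat \<Rightarrow> code" where
  "wk_Q i = (if i = 1 then [wk_under Ce 1, wk_under Cb 1] else [wk_under Cb i, wk_under Ce i])"

definition wk_code :: "nat \<Rightarrow> code" where
  "wk_code n =
     (if n = 0 then []
      else wk_Q 1 @ wk_P 1 @ concat (map (\<lambda>i. wk_Q i @ wk_R (i - 1) @ wk_P i) [2..<Suc n]) @ wk_R n)"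

definition WK :: "nat \<Rightarrow> code set" where
  "WK n = welded_equiv `` {wk_code n}"

end

theory Submission
  imports Defs "HOL-Library.Multiset"
begin

text \<open>
  Only the bound \<open>d\<^sub>T \<le> 1\<close> has content, and one twist move suffices for it: for \<open>1 \<le> k \<le> n\<close>, a
  single twist at \<open>d\<^sub>k\<close> turns \<open>WK\<^sub>n\<close> into \<open>WK\<^bsub>k-1\<^esub>\<close>. All smaller knots of the family are reached
  in this way, and a twist move is an involution, so the distance is at most one in both directions.

  Why the twist has this effect. In \<open>R\<^sub>k = O\<^sub>a O\<^sub>b U\<^sub>d O\<^sub>c O\<^sub>e O\<^sub>f U\<^sub>c O\<^sub>d\<close> the passages \<open>U\<^sub>d O\<^sub>c\<close> keep
  \<open>O\<^sub>b\<close> and \<open>O\<^sub>e\<close> apart. After the twist the word is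
  \<open>O\<^sub>a O\<^sub>b O\<^sub>d O\<^sub>c O\<^sub>e O\<^sub>f U\<^sub>c U\<^sub>d\<close>, and \<open>c\<close>, \<open>d\<close> are removed by a second Reidemeister move. This
  brings \<open>O\<^sub>b\<close> next to \<open>O\<^sub>e\<close>, so these two crossings cancel against \<open>Q\<^sub>k\<close>; finally \<open>O\<^sub>a\<close> meets \<open>O\<^sub>f\<close>,
  and \<open>a\<close>, \<open>f\<close> cancel against \<open>P\<^sub>k\<close> (lemma \<open>untwisted_block_cancels\<close>).

  Once \<open>R\<^sub>k\<close> has gone, nothing separates \<open>Q\<^bsub>k+1\<^esub>\<close> from \<open>P\<^bsub>k+1\<^esub>\<close>, and block \<open>k + 1\<close> disappears in
  another order: in \<open>U\<^sub>b U\<^sub>e U\<^sub>f U\<^sub>a\<close> the pair \<open>e\<close>, \<open>f\<close> cancels first, then \<open>a\<close>, \<open>b\<close>, and then the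
  crossings \<open>c\<close> and \<open>d\<close> are nested kinks (lemma \<open>exposed_block_cancels\<close>). This exposes the next
  block, so that all blocks after \<open>k\<close> collapse in turn (lemma \<open>exposed_tail_cancels\<close>), and the code
  of \<open>WK\<^bsub>k-1\<^esub>\<close> is left over.
\<close>

section \<open>Gauss codes\<close>

lemma gauss_code_cong_mset:
  assumes "mset D = mset D'"
  shows "gauss_code D \<longleftrightarrow> gauss_code D'"
  using mset_eq_setD[OF assms] mset_eq_imp_distinct_iff[OF assms]
  by (simp add: gauss_code_def)

text \<open>
  Read from right to left this constructs Gauss codes crossing by crossing; read from left to right
  it shows that the shorter side of a first or second Reidemeister move is again a Gauss code.
\<close>

lemma gauss_code_add_crossing:
  assumes "mset D' = add_mset (Over x s) (add_mset (Under x s) (mset D))"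
  shows "gauss_code D' \<longleftrightarrow> gauss_code D \<and> x \<notin> label ` set D"
proof -
  have "gauss_code D' \<longleftrightarrow> gauss_code (Over x s # Under x s # D)"
    by (rule gauss_code_cong_mset) (simp add: assms)
  also have "\<dots> \<longleftrightarrow> gauss_code D \<and> x \<notin> label ` set D"
  proof -
    have fresh: "x \<notin> label ` set D" if g: "gauss_code (Over x s # Under x s # D)"
    proof
      assume "x \<in> label ` set D"
      then obtain p where p: "p \<in> set D" "label p = x" by auto
      have "\<forall>p\<in>set (Over x s # Under x s # D). \<forall>q\<in>set (Over x s # Under x s # D).
          label p = label q \<longrightarrow> sign p = sign q"
        using g unfolding gauss_code_def by blast
      from this[THEN bspec, of p, THEN bspec, of "Over x s"] have "sign p = s"
        using p by simp
      then have "p \<in> {Over x s, Under x s}"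
        using p by (cases p) auto
      moreover have "distinct (Over x s # Under x s # D)"
        using g unfolding gauss_code_def by blast
      ultimately show False
        using p(1) by auto
    qed
    have "gauss_code (Over x s # Under x s # D) \<longleftrightarrow> gauss_code D" if "x \<notin> label ` set D"
    proof -
      have ne: "label p \<noteq> x" "x \<noteq> label p" if "p \<in> set D" for p
        using that \<open>x \<notin> label ` set D\<close> by auto
      have no: "Over x t \<notin> set D" "Under x t \<notin> set D" for t
        using ne(1)[of "Over x t"] ne(1)[of "Under x t"] by auto
      have overs_unders: "(Over y t \<in> set (Over x s # Under x s # D)
            \<longleftrightarrow> Under y t \<in> set (Over x s # Under x s # D))
          \<longleftrightarrow> (Over y t \<in> set D \<longleftrightarrow> Under y t \<in> set D)" for y t
        by (cases "y = x"; cases "t = s"; simp add: no)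
      have signs: "(\<forall>p\<in>set (Over x s # Under x s # D). \<forall>q\<in>set (Over x s # Under x s # D).
            label p = label q \<longrightarrow> sign p = sign q)
          \<longleftrightarrow> (\<forall>p\<in>set D. \<forall>q\<in>set D. label p = label q \<longrightarrow> sign p = sign q)"
        using ne by auto
      have dist: "distinct (Over x s # Under x s # D) \<longleftrightarrow> distinct D"
        using no by simp
      show ?thesis
        unfolding gauss_code_def overs_unders signs dist ..
    qed
    with fresh show ?thesis by blast
  qed
  finally show ?thesis .
qed

lemma gauss_code_remove_crossing:
  assumes "gauss_code D'" "mset D' = add_mset (Over x s) (add_mset (Under x s) (mset D))"
  shows "gauss_code D"
  using assms gauss_code_add_crossing by blast

lemma gauss_code_remove_two_crossings:
  assumes "gauss_code D'"
    "mset D' = {#Over x s, Under x s, Over y t, Under y t#} + mset D"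
  shows "gauss_code D"
proof (rule gauss_code_remove_crossing)
  show "gauss_code ([Over y t, Under y t] @ D)"
    by (rule gauss_code_remove_crossing[OF assms(1), of x s]) (simp add: assms(2))
qed simp

section \<open>Removing crossings by welded moves\<close>

lemma welded_equiv_move:
  "\<lbrakk>gauss_code D; gauss_code D'; move D D'\<rbrakk> \<Longrightarrow> (D, D') \<in> welded_equiv"
  by (auto simp: welded_equiv_def welded_move_def)

lemma welded_equiv_sym: "(D, D') \<in> welded_equiv \<Longrightarrow> (D', D) \<in> welded_equiv"
  using equiv_welded_equiv by (meson equivE symE)

lemma welded_equiv_trans [trans]:
  "\<lbrakk>(D, D') \<in> welded_equiv; (D', D'') \<in> welded_equiv\<rbrakk> \<Longrightarrow> (D, D'') \<in> welded_equiv"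
  using equiv_welded_equiv by (meson equivE transE)

lemma welded_equiv_gauss_code: "(D, D') \<in> welded_equiv \<Longrightarrow> gauss_code D'"
  by (simp add: welded_equiv_def)

lemma opp_opp [simp]: "opp (opp s) = s"
  by (cases s) auto

lemma mset_pair [simp]: "mset (pair c p q) = {#p, q#}"
  by (simp add: pair_def)

lemma rotate_equiv:
  assumes "gauss_code (u @ v)"
  shows "(u @ v, v @ u) \<in> welded_equiv"
proof (rule welded_equiv_move[OF assms])
  show "gauss_code (v @ u)"
    using assms gauss_code_cong_mset[of "u @ v" "v @ u"] by simp
qed (rule move.rotate)

lemma remove_kink_over:
  assumes "gauss_code (u @ [Over x s, Under x s] @ v)"
  shows "(u @ [Over x s, Under x s] @ v, u @ v) \<in> welded_equiv"
  by (rule welded_equiv_sym, rule welded_equiv_move)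
    (use gauss_code_remove_crossing[OF assms, of x s "u @ v"] assms in \<open>auto intro: move.RI_over[simplified]\<close>)

lemma remove_kink_under:
  assumes "gauss_code (u @ [Under x s, Over x s] @ v)"
  shows "(u @ [Under x s, Over x s] @ v, u @ v) \<in> welded_equiv"
  by (rule welded_equiv_sym, rule welded_equiv_move)
    (use gauss_code_remove_crossing[OF assms, of x s "u @ v"] assms in \<open>auto intro: move.RI_under[simplified]\<close>)

lemma cancel_pair_overs_first:
  assumes "gauss_code (u @ [Over x s, Over y (opp s)] @ v
             @ pair c (Under x s) (Under y (opp s)) @ w)" (is "gauss_code ?D")
  shows "(u @ [Over x s, Over y (opp s)] @ v
             @ pair c (Under x s) (Under y (opp s)) @ w, u @ v @ w) \<in> welded_equiv"
proof (rule welded_equiv_sym, rule welded_equiv_move[OF _ assms move.RII])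
  show "gauss_code (u @ v @ w)"
    by (rule gauss_code_remove_two_crossings[OF assms, of x s y "opp s"]) simp
qed

lemma cancel_pair_unders_first:
  assumes "gauss_code (u @ pair c (Under x s) (Under y (opp s)) @ v
             @ [Over x s, Over y (opp s)] @ w)"
  shows "(u @ pair c (Under x s) (Under y (opp s)) @ v
             @ [Over x s, Over y (opp s)] @ w, u @ v @ w) \<in> welded_equiv"
proof -
  let ?O = "[Over x s, Over y (opp s)]" and ?U = "pair c (Under x s) (Under y (opp s))"
  have 1: "(u @ ?U @ v @ ?O @ w, ?O @ (w @ u) @ ?U @ v) \<in> welded_equiv"
    using rotate_equiv[of "u @ ?U @ v" "?O @ w"] assms by simp
  also have 2: "(?O @ (w @ u) @ ?U @ v, (w @ u) @ v) \<in> welded_equiv"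
    using cancel_pair_overs_first[of "[]" x s y "w @ u" c v] welded_equiv_gauss_code[OF 1] by simp
  also have "((w @ u) @ v, u @ v @ w) \<in> welded_equiv"
    using rotate_equiv[of w "u @ v"] welded_equiv_gauss_code[OF 2] by simp
  finally show ?thesis .
qed

section \<open>Cancelling a block\<close>

text \<open>
  The word \<open>O\<^sub>a O\<^sub>b O\<^sub>d O\<^sub>c O\<^sub>e O\<^sub>f U\<^sub>c U\<^sub>d\<close> is \<open>R\<^sub>k\<close> after the twist at \<open>d\<close>. The pairs \<open>c, d\<close>, then
  \<open>b, e\<close>, then \<open>a, f\<close> have opposite signs, and removing each makes the next pair of
  over-passages adjacent. The under-passages of \<open>b, e\<close> may come in either order and with either
  sign, which covers both the exceptional \<open>Q\<^sub>1\<close> and the other \<open>Q\<^sub>k\<close>.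
\<close>

lemma untwisted_block_cancels:
  assumes "gauss_code (u @ pair g (Under b s) (Under e (opp s)) @ v @ [Under f Neg, Under a Pos] @ q
    @ [Over a Pos, Over b s, Over d Neg, Over c Pos, Over e (opp s), Over f Neg,
       Under c Pos, Under d Neg] @ r)" (is "gauss_code ?D")
  shows "(u @ pair g (Under b s) (Under e (opp s)) @ v @ [Under f Neg, Under a Pos] @ q
    @ [Over a Pos, Over b s, Over d Neg, Over c Pos, Over e (opp s), Over f Neg,
       Under c Pos, Under d Neg] @ r, u @ v @ q @ r) \<in> welded_equiv"
proof -
  let ?Q = "pair g (Under b s) (Under e (opp s))" and ?P = "[Under f Neg, Under a Pos]"
  have 1: "(?D, u @ ?Q @ v @ ?P @ q
      @ [Over a Pos, Over b s, Over e (opp s), Over f Neg] @ r) \<in> welded_equiv"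
    using cancel_pair_overs_first[of "u @ ?Q @ v @ ?P @ q @ [Over a Pos, Over b s]" d Neg c
        "[Over e (opp s), Over f Neg]" False r] assms
    by (simp add: pair_def[of False])
  also have 2: "(u @ ?Q @ v @ ?P @ q @ [Over a Pos, Over b s, Over e (opp s), Over f Neg] @ r,
      u @ v @ ?P @ q @ [Over a Pos, Over f Neg] @ r) \<in> welded_equiv"
    using cancel_pair_unders_first[of u g b s e "v @ ?P @ q @ [Over a Pos]" "[Over f Neg] @ r"]
      welded_equiv_gauss_code[OF 1] by simp
  also have "(u @ v @ ?P @ q @ [Over a Pos, Over f Neg] @ r, u @ v @ q @ r) \<in> welded_equiv"
    using cancel_pair_unders_first[of "u @ v" False a Pos f q r] welded_equiv_gauss_code[OF 2]
    by (simp add: pair_def)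
  finally show ?thesis .
qed

text \<open>
  Here nothing stands between \<open>Q\<^sub>k = U\<^sub>b U\<^sub>e\<close> and \<open>P\<^sub>k = U\<^sub>f U\<^sub>a\<close>, so the pair \<open>e, f\<close> can be removed
  first. Then \<open>U\<^sub>b\<close> meets \<open>U\<^sub>a\<close>, and \<open>R\<^sub>k\<close> shrinks to the nested kinks \<open>U\<^sub>d O\<^sub>c U\<^sub>c O\<^sub>d\<close>.
\<close>

lemma exposed_block_cancels:
  assumes "gauss_code (u @ [Under b Neg, Under e Pos, Under f Neg, Under a Pos] @ q
    @ [Over a Pos, Over b Neg, Under d s, Over c t, Over e Pos, Over f Neg,
       Under c t, Over d s] @ r)" (is "gauss_code ?D")
  shows "(u @ [Under b Neg, Under e Pos, Under f Neg, Under a Pos] @ q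
    @ [Over a Pos, Over b Neg, Under d s, Over c t, Over e Pos, Over f Neg,
       Under c t, Over d s] @ r, u @ q @ r) \<in> welded_equiv"
proof -
  have 1: "(?D, u @ [Under b Neg, Under a Pos] @ q
      @ [Over a Pos, Over b Neg, Under d s, Over c t, Under c t, Over d s] @ r) \<in> welded_equiv"
    using cancel_pair_unders_first[of "u @ [Under b Neg]" True e Pos f
        "[Under a Pos] @ q @ [Over a Pos, Over b Neg, Under d s, Over c t]"
        "[Under c t, Over d s] @ r"] assms
    by (simp add: pair_def)
  also have 2: "(u @ [Under b Neg, Under a Pos] @ q
      @ [Over a Pos, Over b Neg, Under d s, Over c t, Under c t, Over d s] @ r,
      u @ q @ [Under d s, Over c t, Under c t, Over d s] @ r) \<in> welded_equiv"
    using cancel_pair_unders_first[of u False a Pos b q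
        "[Under d s, Over c t, Under c t, Over d s] @ r"] welded_equiv_gauss_code[OF 1]
    by (simp add: pair_def)
  also have 3: "(u @ q @ [Under d s, Over c t, Under c t, Over d s] @ r,
      u @ q @ [Under d s, Over d s] @ r) \<in> welded_equiv"
    using remove_kink_over[of "u @ q @ [Under d s]" c t "[Over d s] @ r"]
      welded_equiv_gauss_code[OF 2] by simp
  also have "(u @ q @ [Under d s, Over d s] @ r, u @ q @ r) \<in> welded_equiv"
    using remove_kink_under[of "u @ q" d s r] welded_equiv_gauss_code[OF 3] by simp
  finally show ?thesis .
qed

section \<open>The block structure of the codes\<close>

text \<open>The part of the code of \<open>WK\<^sub>n\<close> after \<open>P\<^sub>k\<close>; it contains \<open>R\<^sub>k\<close> and all blocks after \<open>k\<close>.\<close>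

definition wk_tail :: "nat \<Rightarrow> nat \<Rightarrow> code" where
  "wk_tail k n = concat (map (\<lambda>i. wk_Q i @ wk_R (i - 1) @ wk_P i) [Suc k..<Suc n]) @ wk_R n"

lemma wk_tail_self: "wk_tail n n = wk_R n"
  by (simp add: wk_tail_def)

lemma wk_tail_unfold:
  "k < n \<Longrightarrow> wk_tail k n = wk_Q (Suc k) @ wk_R k @ wk_P (Suc k) @ wk_tail (Suc k) n"
  by (simp add: wk_tail_def upt_conv_Cons del: upt_Suc)

lemma wk_code_split:
  assumes "1 \<le> k" "k \<le> n"
  shows "\<exists>u v. wk_code (k - 1) = u @ v \<and> wk_code n = u @ wk_Q k @ v @ wk_P k @ wk_tail k n"
proof (cases "k = 1")
  case True
  then show ?thesis
    using assms by (intro exI[of _ "[]"]) (simp add: wk_code_def wk_tail_def numeral_2_eq_2 del: upt_Suc)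
next
  case False
  let ?B = "\<lambda>i. wk_Q i @ wk_R (i - 1) @ wk_P i"
  have "[2..<Suc n] = [2..<k] @ k # [Suc k..<Suc n]"
    using False assms upt_add_eq_append[of 2 k "Suc n - k"] by (simp add: upt_conv_Cons del: upt_Suc)
  then have "wk_code n = (wk_Q 1 @ wk_P 1 @ concat (map ?B [2..<k]))
      @ wk_Q k @ wk_R (k - 1) @ wk_P k @ wk_tail k n"
    using assms by (simp add: wk_code_def wk_tail_def del: upt_Suc)
  moreover have "wk_code (k - 1) = (wk_Q 1 @ wk_P 1 @ concat (map ?B [2..<k])) @ wk_R (k - 1)"
    using False assms by (simp add: wk_code_def del: upt_Suc)
  ultimately show ?thesis by blast
qed

lemma gauss_code_wk_code: "gauss_code (wk_code n)"
proof -
  have "gauss_code (wk_code n) \<and> (\<forall>x\<in>label ` set (wk_code n). x < 6 * Suc n)"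
  proof (induction n)
    case 0
    show ?case by (simp add: wk_code_def gauss_code_def)
  next
    case (Suc n)
    let ?k = "Suc n" and ?add = "\<lambda>x D. wk_over x (Suc n) # wk_under x (Suc n) # D"
    obtain u v where uv: "wk_code n = u @ v"
      "wk_code ?k = u @ wk_Q ?k @ v @ wk_P ?k @ wk_R ?k"
      using wk_code_split[of ?k ?k] by (auto simp: wk_tail_self)
    have eq: "mset (wk_code ?k)
        = mset (?add Ca (?add Cb (?add Cc (?add Cd (?add Ce (?add Cf (wk_code n)))))))"
      by (simp add: uv wk_Q_def wk_P_def wk_R_def)
    have add: "gauss_code (?add x D)" if "gauss_code D" "wk_label x ?k \<notin> label ` set D" for x D
      using that gauss_code_add_crossing[of "?add x D" "wk_label x ?k" "wk_sign x ?k" D]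
      by (simp add: wk_over_def wk_under_def)
    have fresh: "wk_label x ?k \<notin> label ` set (wk_code n)" for x
      using Suc.IH by (auto simp: wk_label_def)
    have "gauss_code (?add Ca (?add Cb (?add Cc (?add Cd (?add Ce (?add Cf (wk_code n)))))))"
      by (intro add)
        (use Suc.IH fresh in \<open>simp_all add: wk_over_def wk_under_def\<close>,
          simp_all add: wk_label_def)
    moreover have "x < 6 * Suc ?k" if "x \<in> label ` set (wk_code ?k)" for x
      using that Suc.IH unfolding mset_eq_setD[OF eq]
      by (auto simp: wk_over_def wk_under_def wk_label_def)
    ultimately show ?case
      using gauss_code_cong_mset[OF eq] by blast
  qed
  then show ?thesis ..
qed

text \<open>
  Cancelling block \<open>k\<close> removes the word \<open>R\<^sub>k\<close> between \<open>Q\<^bsub>k+1\<^esub>\<close> and \<open>P\<^bsub>k+1\<^esub>\<close>, so the next block is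
  exposed in turn. Block \<open>1\<close> is excluded by \<open>2 \<le> k\<close>: there \<open>Q\<^sub>1 P\<^sub>1 = U\<^sub>e U\<^sub>b U\<^sub>f U\<^sub>a\<close>, and the
  cancellation, which starts with the adjacent pair \<open>U\<^sub>e U\<^sub>f\<close>, does not apply.
\<close>

lemma exposed_tail_cancels:
  assumes "k \<le> n" "2 \<le> k" "gauss_code (u @ wk_Q k @ wk_P k @ wk_tail k n)"
  shows "(u @ wk_Q k @ wk_P k @ wk_tail k n, u) \<in> welded_equiv"
  using assms
proof (induction k rule: inc_induct)
  case base
  then show ?case
    using exposed_block_cancels[of u _ _ _ _ "[]" _ _ _ _ "[]"]
    by (simp add: wk_tail_self wk_Q_def wk_P_def wk_R_def wk_over_def wk_under_def wk_sign_def)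
next
  case (step k)
  have "(u @ wk_Q k @ wk_P k @ wk_tail k n,
      u @ wk_Q (Suc k) @ wk_P (Suc k) @ wk_tail (Suc k) n) \<in> welded_equiv"
    using exposed_block_cancels[of u _ _ _ _ "wk_Q (Suc k)" _ _ _ _
        "wk_P (Suc k) @ wk_tail (Suc k) n"] step.hyps step.prems
    by (simp add: wk_tail_unfold wk_Q_def[of k] wk_P_def[of k] wk_R_def[of k]
        wk_over_def wk_under_def wk_sign_def)
  also from this have "(u @ wk_Q (Suc k) @ wk_P (Suc k) @ wk_tail (Suc k) n, u) \<in> welded_equiv"
    using step by (auto dest: welded_equiv_gauss_code)
  finally show ?case .
qed

section \<open>Twist moves\<close>

lemma twist_passage_twist_passage [simp]: "twist_passage x (twist_passage x p) = p"
  by (cases p) auto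

lemma twist_twist [simp]: "twist x (twist x D) = D"
  by (simp add: twist_def comp_def)

lemma label_twist_passage [simp]: "label (twist_passage x p) = label p"
  by (cases p) auto

lemma labels_twist [simp]: "label ` set (twist x D) = label ` set D"
  by (simp add: twist_def image_image)

text \<open>
  A passage of \<open>x\<close> outside the two displayed ones would repeat one of them, so the twist
  changes nothing else.
\<close>

lemma twist_code:
  assumes "gauss_code (u @ [Under x s] @ v @ [Over x s] @ w)"
  shows "twist x (u @ [Under x s] @ v @ [Over x s] @ w) = u @ [Over x s] @ v @ [Under x s] @ w"
    and "gauss_code (u @ [Over x s] @ v @ [Under x s] @ w)"
proof -
  have "x \<notin> label ` set (u @ v @ w)"
    using gauss_code_add_crossing[of "u @ [Under x s] @ v @ [Over x s] @ w" x s "u @ v @ w"] assms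
    by simp
  moreover have "twist_passage x p = p" if "label p \<noteq> x" for p
    using that by (cases p) auto
  ultimately have id: "map (twist_passage x) D = D" if "set D \<subseteq> set (u @ v @ w)" for D
    using that by (intro map_idI) (metis image_eqI subsetD)
  show "twist x (u @ [Under x s] @ v @ [Over x s] @ w) = u @ [Over x s] @ v @ [Under x s] @ w"
    using id[of u] id[of v] id[of w] by (auto simp: twist_def)
  show "gauss_code (u @ [Over x s] @ v @ [Under x s] @ w)"
    using gauss_code_cong_mset[THEN iffD1, OF _ assms] by simp
qed

lemma twist_wk_code:
  assumes "1 \<le> k" "k \<le> n"
  shows "(twist (wk_label Cd k) (wk_code n), wk_code (k - 1)) \<in> welded_equiv"
proof -
  obtain u v where uv: "wk_code (k - 1) = u @ v"
    "wk_code n = u @ wk_Q k @ v @ wk_P k @ wk_tail k n"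
    using wk_code_split[OF assms] by blast
  define q where "q = (if k = n then [] else wk_Q (Suc k))"
  define r where "r = (if k = n then [] else wk_P (Suc k) @ wk_tail (Suc k) n)"
  have tail: "wk_tail k n = q @ wk_R k @ r"
    using assms wk_tail_unfold[of k n] by (simp add: q_def r_def wk_tail_self)
  let ?a = "wk_label Ca k" and ?b = "wk_label Cb k" and ?c = "wk_label Cc k"
    and ?d = "wk_label Cd k" and ?e = "wk_label Ce k" and ?f = "wk_label Cf k"
  let ?s = "wk_sign Cb k"
  \<comment> \<open>\<open>Q\<^sub>1\<close> lists \<open>e\<close> first, every other \<open>Q\<^sub>k\<close> lists \<open>b\<close> first.\<close>
  have Q: "wk_Q k = pair (k \<noteq> 1) (Under ?b ?s) (Under ?e (opp ?s))"
    by (simp add: wk_Q_def pair_def wk_under_def wk_sign_def)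
  have P: "wk_P k = [Under ?f Neg, Under ?a Pos]"
    by (simp add: wk_P_def wk_under_def wk_sign_def)
  have R: "wk_R k = [Over ?a Pos, Over ?b ?s, Under ?d Neg, Over ?c Pos, Over ?e (opp ?s),
      Over ?f Neg, Under ?c Pos, Over ?d Neg]"
    by (simp add: wk_R_def wk_over_def wk_under_def wk_sign_def)
  let ?p = "u @ wk_Q k @ v @ wk_P k @ q @ [Over ?a Pos, Over ?b ?s]"
    and ?m = "[Over ?c Pos, Over ?e (opp ?s), Over ?f Neg, Under ?c Pos]"
  have code: "wk_code n = ?p @ [Under ?d Neg] @ ?m @ [Over ?d Neg] @ r"
    by (simp add: uv(2) tail R)
  note tw = twist_code[of ?p ?d Neg ?m r, folded code, OF gauss_code_wk_code]
  have 1: "(twist ?d (wk_code n), u @ v @ q @ r) \<in> welded_equiv"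
    using untwisted_block_cancels[of u "k \<noteq> 1" ?b ?s ?e v ?f ?a q ?d ?c r] tw
    by (simp add: Q P)
  also have "(u @ v @ q @ r, u @ v) \<in> welded_equiv"
  proof (cases "k = n")
    case True
    then show ?thesis
      using welded_equiv_gauss_code[OF 1] by (simp add: q_def r_def welded_equiv_def)
  next
    case False
    then show ?thesis
      using exposed_tail_cancels[of "Suc k" n "u @ v"] welded_equiv_gauss_code[OF 1] assms
      by (simp add: q_def r_def)
  qed
  finally show ?thesis by (simp only: uv(1))
qed

section \<open>The twist distance\<close>

lemma twist_distance_le_1:
  assumes "D \<in> K" "D' \<in> K'" "gauss_code D" "x \<in> label ` set D" "twist x D = D'"
  shows "twist_distance K K' \<le> 1"
  unfolding twist_distance_def
proof (rule Inf_lower)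
  have "twist_seq (Suc 0) D D'"
    using twist_seq.twist[OF twist_seq.start] assms by blast
  then show "1 \<in> {enat k |k. \<exists>D\<in>K. \<exists>D'\<in>K'. twist_seq k D D'}"
    using assms by (auto simp: one_enat_def)
qed

lemma twist_distance_WK_less:
  assumes "m < n"
  shows "twist_distance (WK m) (WK n) \<le> 1" and "twist_distance (WK n) (WK m) \<le> 1"
proof -
  let ?d = "wk_label Cd (Suc m)"
  have eq: "(twist ?d (wk_code n), wk_code m) \<in> welded_equiv"
    using twist_wk_code[of "Suc m" n] assms by simp
  obtain u v where "wk_code n = u @ wk_Q (Suc m) @ v @ wk_P (Suc m) @ wk_tail (Suc m) n"
    using wk_code_split[of "Suc m" n] assms by auto
  moreover have "?d \<in> label ` set (wk_tail (Suc m) n)"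
  proof -
    have "?d \<in> label ` set (wk_R (Suc m))"
      by (simp add: wk_R_def wk_over_def)
    then show ?thesis
      using assms wk_tail_self[of n] wk_tail_unfold[of "Suc m" n]
      by (cases "Suc m = n") auto
  qed
  ultimately have d: "?d \<in> label ` set (wk_code n)"
    by auto
  have n: "wk_code n \<in> WK n"
    using gauss_code_wk_code by (simp add: WK_def welded_equiv_def)
  have m: "twist ?d (wk_code n) \<in> WK m"
    using welded_equiv_sym[OF eq] by (simp add: WK_def)
  have g: "gauss_code (twist ?d (wk_code n))"
    using eq by (simp add: welded_equiv_def)
  show "twist_distance (WK n) (WK m) \<le> 1"
    by (rule twist_distance_le_1[OF n m gauss_code_wk_code d refl])
  show "twist_distance (WK m) (WK n) \<le> 1"
    by (rule twist_distance_le_1[OF m n g, of ?d]) (use d in simp_all)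
qed

theorem theorem6p1:
  shows "(\<forall>n. {WK n} \<in> gordian_complex) \<and>
         (\<forall>m n. m \<noteq> n \<longrightarrow> twist_distance (WK m) (WK n) \<le> 1)"
proof (intro conjI allI impI)
  fix n
  have "WK n \<in> welded_knots"
    unfolding welded_knots_def WK_def by (rule quotientI) (simp add: gauss_code_wk_code)
  then show "{WK n} \<in> gordian_complex"
    by (simp add: gordian_complex_def)
next
  fix m n :: nat
  assume "m \<noteq> n"
  then show "twist_distance (WK m) (WK n) \<le> 1"
    using twist_distance_WK_less by (metis linorder_neqE_nat)
qed

end
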